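(* Let $G=(V,E)$ be a finite undirected unweighted simple graph, let $\mathbf{L}$ be its Laplacian matrix and let $\mathbf{W}=(\mathbf{I}+\mathbf{L})^{-1}=(w_{ij})$ be its forest matrix. For $u\in V$ let $\mathcal{F}_{uu}$ be the set of spanning rooted forests of $G$ in which $u$ is a root, and define $$s(u)=\frac{1}{|\mathcal{F}_{uu}|}\sum_{F\in\mathcal{F}_{uu}}|F|_u,$$ where $|F|_u$ is the number of vertices of the tree rooted at $u$ in $F$. Define $\mathrm{ForestSim}(u,v)=\frac{\min(s(u),s(v))}{\max(s(u),s(v))}$. Then for all $u,v\in V$, $$\mathrm{ForestSim}(u,v)=\frac{\min(w_{uu},w_{vv})}{\max(w_{uu},w_{vv})}.$$
   Context: For $G$ with adjacency matrix $\mathbf{A}$ and diagonal degree matrix $\mathbf{D}=\mathrm{diag}(d_1,\dots,d_n)$, the Laplacian is $\mathbf{L}=\mathbf{D}-\mathbf{A}$, and $\mathbf{I}$ is the $n\times n$ identity matrix. A spanning forest of $G$ is an acyclic subgraph containing all vertices of $G$; a spanning rooted forest is a spanning forest with one root marked in each of its trees. *)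

theory Defs
  imports "HOL-Analysis.Analysis"
begin

definition simple_graph :: "('n \<Rightarrow> 'n \<Rightarrow> bool) \<Rightarrow> bool" where
  "simple_graph E \<longleftrightarrow> (\<forall>u v. E u v \<longrightarrow> E v u) \<and> (\<forall>u. \<not> E u u)"

definition degree :: "('n::finite \<Rightarrow> 'n \<Rightarrow> bool) \<Rightarrow> 'n \<Rightarrow> nat" where
  "degree E u = card {v. E u v}"

definition adjacency_matrix :: "('n::finite \<Rightarrow> 'n \<Rightarrow> bool) \<Rightarrow> real^'n^'n" where
  "adjacency_matrix E = (\<chi> i j. if E i j then 1 else 0)"

definition degree_matrix :: "('n::finite \<Rightarrow> 'n \<Rightarrow> bool) \<Rightarrow> real^'n^'n" where
  "degree_matrix E = (\<chi> i j. if i = j then real (degree E i) else 0)"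

definition laplacian :: "('n::finite \<Rightarrow> 'n \<Rightarrow> bool) \<Rightarrow> real^'n^'n" where
  "laplacian E = degree_matrix E - adjacency_matrix E"

definition forest_matrix :: "('n::finite \<Rightarrow> 'n \<Rightarrow> bool) \<Rightarrow> real^'n^'n" where
  "forest_matrix E = matrix_inv (mat 1 + laplacian E)"

definition graph_edges :: "('n \<Rightarrow> 'n \<Rightarrow> bool) \<Rightarrow> 'n set set" where
  "graph_edges E = {{u, v} | u v. E u v}"

definition has_cycle :: "'n set set \<Rightarrow> bool" where
  "has_cycle F \<longleftrightarrow> (\<exists>vs. length vs \<ge> 3 \<and> distinct vs \<and>
      (\<forall>i < length vs. {vs ! i, vs ! ((i + 1) mod length vs)} \<in> F))"

text \<open>Spanning forest of G: an acyclic subgraph containing all vertices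
  (all vertices of the type are present), given by its edge set.\<close>
definition spanning_forest :: "('n \<Rightarrow> 'n \<Rightarrow> bool) \<Rightarrow> 'n set set \<Rightarrow> bool" where
  "spanning_forest E F \<longleftrightarrow> F \<subseteq> graph_edges E \<and> \<not> has_cycle F"

definition conn :: "'n set set \<Rightarrow> 'n \<Rightarrow> 'n \<Rightarrow> bool" where
  "conn F = (\<lambda>x y. {x, y} \<in> F)\<^sup>*\<^sup>*"

definition spanning_rooted_forest :: "('n \<Rightarrow> 'n \<Rightarrow> bool) \<Rightarrow> 'n set set \<times> 'n set \<Rightarrow> bool" where
  "spanning_rooted_forest E FR \<longleftrightarrow> (case FR of (F, R) \<Rightarrow>
      spanning_forest E F \<and> (\<forall>v. \<exists>!r. r \<in> R \<and> conn F v r))"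

definition forests_rooted_at :: "('n \<Rightarrow> 'n \<Rightarrow> bool) \<Rightarrow> 'n \<Rightarrow> ('n set set \<times> 'n set) set" where
  "forests_rooted_at E u = {FR. spanning_rooted_forest E FR \<and> u \<in> snd FR}"

definition tree_size :: "'n::finite set set \<Rightarrow> 'n \<Rightarrow> nat" where
  "tree_size F u = card {v. conn F u v}"

definition s_val :: "('n::finite \<Rightarrow> 'n \<Rightarrow> bool) \<Rightarrow> 'n \<Rightarrow> real" where
  "s_val E u = (\<Sum>FR\<in>forests_rooted_at E u. real (tree_size (fst FR) u))
                 / real (card (forests_rooted_at E u))"

definition forest_sim :: "('n::finite \<Rightarrow> 'n \<Rightarrow> bool) \<Rightarrow> 'n \<Rightarrow> 'n \<Rightarrow> real" where
  "forest_sim E u v = min (s_val E u) (s_val E v) / max (s_val E u) (s_val E v)"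

end

theory Submission
  imports Defs
begin

text \<open>
  Let \<open>N i j\<close> be the number of spanning rooted forests in which \<open>j\<close> is the root of the tree
  containing \<open>i\<close>, and let \<open>f\<close> be the number of all spanning rooted forests. Every forest in which
  \<open>i\<close> is not a root arises uniquely from one in which \<open>i\<close> is a root by joining \<open>i\<close> to a
  neighbour in another tree. Grouping the forests accordingly yields \<open>(I + L) N = f I\<close>, so that
  \<open>W = N / f\<close>. As the columns of \<open>L\<close> sum to zero, those of \<open>N\<close> sum to \<open>f\<close>; but the sum of the
  column of \<open>u\<close> also is the numerator of \<open>s u\<close>. Hence \<open>s u = f / N u u = 1 / w\<^sub>u\<^sub>u\<close>.
\<close>

section \<open>Connectivity and acyclicity\<close>

lemma conn_refl [simp]: "conn F x x"
  by (simp add: conn_def)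

lemma conn_trans: "conn F x y \<Longrightarrow> conn F y z \<Longrightarrow> conn F x z"
  by (simp add: conn_def)

lemma conn_sym: "conn F x y \<Longrightarrow> conn F y x"
  unfolding conn_def
  by (rule sympD[OF symp_rtranclp]) (auto intro: sympI simp: insert_commute)

lemma conn_commute: "conn F x y \<longleftrightarrow> conn F y x"
  using conn_sym by metis

lemma conn_edge: "{x, y} \<in> F \<Longrightarrow> conn F x y"
  by (auto simp: conn_def)

lemma conn_mono: "conn F x y \<Longrightarrow> F \<subseteq> G \<Longrightarrow> conn G x y"
  unfolding conn_def by (rule rtranclp_mono[THEN predicate2D, rotated]) auto

lemma conn_empty_iff [simp]: "conn {} x y \<longleftrightarrow> x = y"
proof
  assume "conn {} x y"
  then show "x = y"
    unfolding conn_def by (induction rule: rtranclp_induct) auto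
qed simp

text \<open>A second crossing of the new edge undoes the first, so a walk needs it at most once, in
  one direction or the other.\<close>

lemma conn_insert_iff:
  "conn (insert {a, b} F) x y \<longleftrightarrow>
     conn F x y \<or> (conn F x a \<and> conn F b y) \<or> (conn F x b \<and> conn F a y)" (is "?L \<longleftrightarrow> ?R y")
proof
  assume ?L
  then show "?R y"
    unfolding conn_def[of "insert {a, b} F"]
  proof (induction rule: rtranclp_induct)
    case (step y z)
    from step.hyps(2) consider "{y, z} \<in> F" | "y = a" "z = b" | "y = b" "z = a"
      by (auto simp: doubleton_eq_iff)
    then show ?case
    proof cases
      case 1
      then show ?thesis using step.IH conn_edge conn_trans by metis
    qed (use step.IH in auto)
  qed simp
next
  have *: "conn (insert {a, b} F) a b" "conn (insert {a, b} F) b a"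
    by (auto intro: conn_edge simp: insert_commute)
  have "conn F p q \<Longrightarrow> conn (insert {a, b} F) p q" for p q
    by (rule conn_mono) auto
  then show "?R y \<Longrightarrow> ?L"
    using * conn_trans by metis
qed

text \<open>A path that would run into a vertex already on it is cut back to that vertex. This
  yields the distinct vertex list that \<open>has_cycle\<close> asks for.\<close>

lemma conn_simple_path:
  assumes "conn F x y"
  obtains vs where "vs \<noteq> []" "hd vs = x" "last vs = y" "distinct vs"
    "successively (\<lambda>a b. {a, b} \<in> F) vs"
proof -
  have "\<exists>vs. vs \<noteq> [] \<and> hd vs = x \<and> last vs = y \<and> distinct vs \<and>
      successively (\<lambda>a b. {a, b} \<in> F) vs"
    using assms unfolding conn_def
  proof (induction rule: rtranclp_induct)
    case base
    show ?case by (rule exI[of _ "[x]"]) auto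
  next
    case (step y z)
    then obtain vs where vs: "vs \<noteq> []" "hd vs = x" "last vs = y" "distinct vs"
      "successively (\<lambda>a b. {a, b} \<in> F) vs" by blast
    show ?case
    proof (cases "z \<in> set vs")
      case True
      then obtain ps qs where "vs = ps @ z # qs" by (auto dest: split_list)
      with vs show ?thesis
        by (intro exI[of _ "ps @ [z]"]) (auto simp: successively_append_iff hd_append split: if_splits)
    next
      case False
      with vs step.hyps(2) show ?thesis
        by (intro exI[of _ "vs @ [z]"]) (auto simp: successively_append_iff)
    qed
  qed
  then show ?thesis using that by blast
qed

text \<open>A cycle without its closing edge still joins the ends of that edge; conversely, a simple
  path avoiding an edge between its ends closes up to a cycle. This trades index lists for
  connectivity.\<close>

lemma has_cycle_iff_non_bridge:
  "has_cycle F \<longleftrightarrow> (\<exists>x y. x \<noteq> y \<and> {x, y} \<in> F \<and> conn (F - {{x, y}}) x y)"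
proof
  assume "has_cycle F"
  then obtain vs where len: "length vs \<ge> 3" and dist: "distinct vs"
    and edges: "\<And>i. i < length vs \<Longrightarrow> {vs ! i, vs ! ((i + 1) mod length vs)} \<in> F"
    unfolding has_cycle_def by blast
  define n where "n = length vs - 1"
  have n: "length vs = Suc n" "n \<ge> 2" using len by (auto simp: n_def)
  let ?G = "F - {{vs ! 0, vs ! n}}"
  have "conn ?G (vs ! 0) (vs ! j)" if "j \<le> n" for j
    using that
  proof (induction j)
    case (Suc j)
    have "{vs ! j, vs ! Suc j} \<in> F"
      using edges[of j] Suc.prems n by simp
    \<comment> \<open>Because \<open>n \<ge> 2\<close>, the closing edge is not one of the edges
      between consecutive list entries.\<close>
    moreover have "{vs ! j, vs ! Suc j} \<noteq> {vs ! 0, vs ! n}"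
      using Suc.prems n dist by (auto simp: doubleton_eq_iff nth_eq_iff_index_eq)
    ultimately have "conn ?G (vs ! j) (vs ! Suc j)"
      by (intro conn_edge) auto
    with Suc show ?case by (auto intro: conn_trans)
  qed simp
  moreover have "{vs ! 0, vs ! n} \<in> F"
    using edges[of n] n by (simp add: insert_commute)
  moreover have "vs ! 0 \<noteq> vs ! n"
    using n dist by (auto simp: nth_eq_iff_index_eq)
  ultimately show "\<exists>x y. x \<noteq> y \<and> {x, y} \<in> F \<and> conn (F - {{x, y}}) x y"
    by blast
next
  assume "\<exists>x y. x \<noteq> y \<and> {x, y} \<in> F \<and> conn (F - {{x, y}}) x y"
  then obtain x y where xy: "x \<noteq> y" "{x, y} \<in> F" "conn (F - {{x, y}}) x y" by blast
  then obtain vs where vs: "vs \<noteq> []" "hd vs = x" "last vs = y" "distinct vs"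
    and path: "successively (\<lambda>a b. {a, b} \<in> F - {{x, y}}) vs"
    by (elim conn_simple_path)
  have step: "{vs ! i, vs ! Suc i} \<in> F - {{x, y}}" if "Suc i < length vs" for i
    using path that by (auto simp: successively_conv_nth)
  have ends: "vs ! 0 = x" "vs ! (length vs - 1) = y"
    using vs by (auto simp: hd_conv_nth last_conv_nth)
  \<comment> \<open>A path on two vertices would consist of the deleted edge \<open>{x, y}\<close>
    itself.\<close>
  have "length vs \<noteq> 0" "length vs \<noteq> 1" "length vs \<noteq> 2"
    using vs(1) ends xy(1) step[of 0] by auto
  then have len: "length vs \<ge> 3" by linarith
  have "{vs ! i, vs ! ((i + 1) mod length vs)} \<in> F" if "i < length vs" for i
  proof (cases "Suc i < length vs")
    case True
    then show ?thesis using step[of i] by simp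
  next
    case False
    then have "i + 1 = length vs" using that by simp
    then have "i = length vs - 1" "(i + 1) mod length vs = 0" by simp_all
    then show ?thesis using ends xy(2) by (simp add: insert_commute)
  qed
  with len vs(4) show "has_cycle F" unfolding has_cycle_def by blast
qed

text \<open>If the non-bridge is the new edge, then \<open>F\<close> already connects
  \<open>a\<close> and \<open>b\<close>. Otherwise its detour must cross the new edge, and the rest
  of the detour together with \<open>{x, y}\<close> connects \<open>a\<close> and \<open>b\<close>
  in \<open>F\<close>.\<close>

lemma acyclic_insert:
  assumes "\<not> has_cycle F" "\<not> conn F a b"
  shows "\<not> has_cycle (insert {a, b} F)"
proof
  assume "has_cycle (insert {a, b} F)"
  then obtain x y where xy: "x \<noteq> y" "{x, y} \<in> insert {a, b} F"
    "conn (insert {a, b} F - {{x, y}}) x y"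
    unfolding has_cycle_iff_non_bridge by blast
  show False
  proof (cases "{x, y} = {a, b}")
    case True
    then have "conn F x y" using xy(3) by (auto elim: conn_mono)
    with True assms(2) show False
      by (auto simp: doubleton_eq_iff dest: conn_sym)
  next
    case False
    let ?H = "F - {{x, y}}"
    have xyF: "{x, y} \<in> F" using xy(2) False by auto
    have "insert {a, b} F - {{x, y}} = insert {a, b} ?H" using False by auto
    then have "conn ?H x y \<or> (conn ?H x a \<and> conn ?H b y) \<or> (conn ?H x b \<and> conn ?H a y)"
      using xy(3) by (simp add: conn_insert_iff)
    moreover have "\<not> conn ?H x y"
      using assms(1) xy(1) xyF unfolding has_cycle_iff_non_bridge by blast
    moreover have "conn ?H p q \<Longrightarrow> conn F p q" for p q
      by (rule conn_mono) auto
    ultimately show False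
      using conn_edge[OF xyF] assms(2) conn_trans conn_sym by metis
  qed
qed

lemma acyclic_subset:
  assumes "\<not> has_cycle F" "G \<subseteq> F"
  shows "\<not> has_cycle G"
  using assms unfolding has_cycle_def by blast

text \<open>The witness \<open>k\<close> is the vertex right after the last visit of the walk to
  \<open>a\<close>; from there on the walk no longer uses an edge at \<open>a\<close>.\<close>

lemma conn_first_edge:
  assumes "conn F a r"
  shows "r = a \<or> (\<exists>k. {a, k} \<in> F \<and> conn (F - {{a, k}}) k r)"
  using assms unfolding conn_def[of F]
proof (induction rule: rtranclp_induct)
  case (step y z)
  show ?case
  proof (cases "z = a \<or> y = a")
    case True
    then show ?thesis using step.hyps(2) by auto
  next
    case False
    then obtain k where k: "{a, k} \<in> F" "conn (F - {{a, k}}) k y" using step.IH by auto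
    have "{y, z} \<in> F - {{a, k}}" using step.hyps(2) False by (auto simp: doubleton_eq_iff)
    then show ?thesis using k conn_edge conn_trans by metis
  qed
qed simp

section \<open>Joining a root to a neighbour in another tree\<close>

abbreviation rooted_forests :: "('n \<Rightarrow> 'n \<Rightarrow> bool) \<Rightarrow> ('n set set \<times> 'n set) set" where
  "rooted_forests E \<equiv> {FR. spanning_rooted_forest E FR}"

abbreviation join_root :: "'n \<Rightarrow> ('n set set \<times> 'n set) \<times> 'n \<Rightarrow> 'n set set \<times> 'n set" where
  "join_root i \<equiv> \<lambda>((F, R), k). (insert {i, k} F, R - {i})"

abbreviation joinable :: "('n \<Rightarrow> 'n \<Rightarrow> bool) \<Rightarrow> 'n \<Rightarrow> (('n set set \<times> 'n set) \<times> 'n) set" where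
  "joinable E i \<equiv> SIGMA FR : forests_rooted_at E i. {k. E i k \<and> \<not> conn (fst FR) i k}"

lemma rooted_forestD:
  assumes "spanning_rooted_forest E (F, R)"
  shows "F \<subseteq> graph_edges E" "\<not> has_cycle F" "\<exists>r\<in>R. conn F x r"
    "r \<in> R \<Longrightarrow> s \<in> R \<Longrightarrow> conn F x r \<Longrightarrow> conn F x s \<Longrightarrow> r = s"
  using assms unfolding spanning_rooted_forest_def spanning_forest_def by auto

lemma rooted_forestI:
  assumes "F \<subseteq> graph_edges E" "\<not> has_cycle F" "\<And>x. \<exists>r\<in>R. conn F x r"
    "\<And>x r s. r \<in> R \<Longrightarrow> s \<in> R \<Longrightarrow> conn F x r \<Longrightarrow> conn F x s \<Longrightarrow> r = s"
  shows "spanning_rooted_forest E (F, R)"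
proof -
  have "\<exists>!r. r \<in> R \<and> conn F x r" for x
    using assms(3)[of x] assms(4)[of _ _ x] by blast
  with assms(1,2) show ?thesis
    unfolding spanning_rooted_forest_def spanning_forest_def by simp
qed

lemma graph_edges_iff:
  "simple_graph E \<Longrightarrow> {x, y} \<in> graph_edges E \<longleftrightarrow> E x y"
  unfolding simple_graph_def graph_edges_def by (auto simp: doubleton_eq_iff)

text \<open>The remaining case of \<open>conn_insert_iff\<close> would put the two roots
  \<open>i\<close> and \<open>r\<close> into one tree.\<close>

lemma conn_joined_root_iff:
  assumes "spanning_rooted_forest E (F, R)" "i \<in> R" "r \<in> R" "r \<noteq> i"
  shows "conn (insert {i, k} F) x r \<longleftrightarrow> conn F x r \<or> (conn F x i \<and> conn F k r)"
proof -
  have "\<not> conn F i r"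
    using rooted_forestD(4)[OF assms(1,3,2), of i] assms(4) by auto
  then show ?thesis by (simp add: conn_insert_iff)
qed

text \<open>The tree of \<open>i\<close> is absorbed by the tree of \<open>k\<close> and takes over
  its root; all other trees keep theirs.\<close>

lemma join_root_rooted_forest:
  assumes "simple_graph E" "spanning_rooted_forest E (F, R)" "i \<in> R" "E i k" "\<not> conn F i k"
  shows "spanning_rooted_forest E (insert {i, k} F, R - {i})"
proof (rule rooted_forestI)
  note F = rooted_forestD[OF assms(2)]
  note root = conn_joined_root_iff[OF assms(2,3)]
  show "insert {i, k} F \<subseteq> graph_edges E"
    using F(1) assms(1,4) by (simp add: graph_edges_iff)
  show "\<not> has_cycle (insert {i, k} F)"
    using F(2) assms(5) by (rule acyclic_insert)
  obtain rk where rk: "rk \<in> R" "conn F k rk" using F(3) by blast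
  have "rk \<noteq> i" using rk assms(5) conn_sym by metis
  show "\<exists>r\<in>R - {i}. conn (insert {i, k} F) x r" for x
  proof -
    obtain r where r: "r \<in> R" "conn F x r" using F(3) by blast
    show ?thesis
      by (cases "r = i") (use r rk root \<open>rk \<noteq> i\<close> in blast)+
  qed
  have no: False if "conn F x i" "conn F x r" "r \<in> R" "r \<noteq> i" for x r
    using F(4)[OF that(3) assms(3) that(2,1)] that(4) by simp
  show "r = s" if "r \<in> R - {i}" "s \<in> R - {i}" "conn (insert {i, k} F) x r"
    "conn (insert {i, k} F) x s" for x r s
  proof (cases "conn F x i")
    case True
    then have "conn F k r" "conn F k s" using that root no by blast+
    then show ?thesis using F(4) that by blast
  next
    case False
    then have "conn F x r" "conn F x s" using that root by blast+
    then show ?thesis using F(4) that by blast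
  qed
qed

text \<open>This undoes \<open>join_root\<close>: cutting the first edge on the way from
  \<open>i\<close> to its root \<open>r\<close> leaves \<open>k\<close> with \<open>r\<close> and
  frees a tree in which \<open>i\<close> can be the root.\<close>

lemma detach_rooted_forest:
  assumes "simple_graph E" "spanning_rooted_forest E (F, R)" "i \<notin> R"
  obtains k where "{i, k} \<in> F" "E i k" "\<not> conn (F - {{i, k}}) i k"
    "spanning_rooted_forest E (F - {{i, k}}, insert i R)"
proof -
  note F = rooted_forestD[OF assms(2)]
  obtain r where r: "r \<in> R" "conn F i r" using F(3) by blast
  have "r \<noteq> i" using r(1) assms(3) by auto
  then obtain k where k: "{i, k} \<in> F" "conn (F - {{i, k}}) k r"
    using conn_first_edge[OF r(2)] by blast
  let ?G = "F - {{i, k}}"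
  have E: "E i k" using subsetD[OF F(1) k(1)] assms(1) by (simp add: graph_edges_iff)
  then have "i \<noteq> k" using assms(1) unfolding simple_graph_def by auto
  then have sep: "\<not> conn ?G i k"
    using F(2) k(1) by (auto simp: has_cycle_iff_non_bridge)
  have sub: "conn ?G p q \<Longrightarrow> conn F p q" for p q
    by (rule conn_mono) auto
  have F_eq: "F = insert {i, k} ?G" using k(1) by auto
  \<comment> \<open>The piece cut off with \<open>i\<close> contains no old root: such a root could
    only be \<open>r\<close>, which stays with \<open>k\<close>.\<close>
  have G_i: "\<not> conn ?G i s" if "s \<in> R" for s
  proof
    assume "conn ?G i s"
    then have "s = r" using F(4)[OF that r(1) sub r(2)] by simp
    then show False
      using \<open>conn ?G i s\<close> k(2) sep conn_trans conn_sym by metis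
  qed
  have "spanning_rooted_forest E (?G, insert i R)"
  proof (rule rooted_forestI)
    show "?G \<subseteq> graph_edges E" using F(1) by auto
    show "\<not> has_cycle ?G" using F(2) by (rule acyclic_subset) auto
    show "\<exists>s\<in>insert i R. conn ?G x s" for x
    proof -
      obtain s where s: "s \<in> R" "conn F x s" using F(3) by blast
      then have "conn (insert {i, k} ?G) x s" using F_eq by simp
      then have "conn ?G x s \<or> conn ?G x i \<or> conn ?G x k"
        unfolding conn_insert_iff by blast
      then show ?thesis using s(1) r(1) conn_trans[OF _ k(2), of x] by blast
    qed
    have no: False if "conn ?G x i" "conn ?G x s" "s \<in> R" for x s
      using G_i[OF that(3)] conn_trans[OF conn_sym[OF that(1)] that(2)] by simp
    show "s = t" if "s \<in> insert i R" "t \<in> insert i R" "conn ?G x s" "conn ?G x t" for x s t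
      using that no[of x] F(4)[of s t x] sub by blast
  qed
  with k(1) E sep show ?thesis by (rule that)
qed

lemma bij_betw_join_root:
  assumes "simple_graph E"
  shows "bij_betw (join_root i) (joinable E i) {FR \<in> rooted_forests E. i \<notin> snd FR}"
  unfolding bij_betw_def
proof
  show "inj_on (join_root i) (joinable E i)"
  proof (rule inj_onI, clarsimp simp: forests_rooted_at_def)
    fix F R k F' R' k'
    assume rf: "spanning_rooted_forest E (F, R)" "spanning_rooted_forest E (F', R')"
      and i: "i \<in> R" "i \<in> R'"
      and k: "E i k" "\<not> conn F i k" "E i k'" "\<not> conn F' i k'"
      and eq: "insert {i, k} F = insert {i, k'} F'" "R - {i} = R' - {i}"
    have R: "R = R'" using i eq(2) by auto
    \<comment> \<open>If \<open>k\<close> and \<open>k'\<close> differ, each forest contains the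
      edge added to the other. In \<open>F'\<close> the path from \<open>k'\<close> to its root
      \<open>r\<close> stays outside the tree of \<open>i\<close>, so it avoids
      \<open>{i, k}\<close> and lies in \<open>F\<close>. There \<open>{i, k'}\<close> extends it to
      a connection of the two roots \<open>i\<close> and \<open>r\<close>.\<close>
    have "k = k'"
    proof (rule ccontr)
      assume neq: "k \<noteq> k'"
      obtain r where r: "r \<in> R'" "conn F' k' r" using rooted_forestD(3)[OF rf(2)] by blast
      have "r \<noteq> i" using r k(4) conn_sym by metis
      from neq have "{i, k} \<noteq> {i, k'}" by (auto simp: doubleton_eq_iff)
      moreover have "{i, k} \<in> insert {i, k'} F'" "{i, k'} \<in> insert {i, k} F"
        by (simp flip: eq(1), simp add: eq(1))
      ultimately have ik: "{i, k} \<in> F'" "{i, k'} \<in> F" by auto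
      have F': "insert {i, k} (F' - {{i, k}}) = F'" using ik(1) by (rule insert_Diff)
      have "conn (F' - {{i, k}}) k' r"
      proof -
        have no: "\<not> conn F' k' i" using k(4) by (simp add: conn_commute)
        then have no': "\<not> conn F' k' k"
          using conn_trans[OF _ conn_sym[OF conn_edge[OF ik(1)]]] by blast
        have "conn (insert {i, k} (F' - {{i, k}})) k' r" using r(2) F' by simp
        moreover have "\<not> conn (F' - {{i, k}}) k' i" "\<not> conn (F' - {{i, k}}) k' k"
          using no no' conn_mono[OF _ Diff_subset] by metis+
        ultimately show ?thesis by (simp add: conn_insert_iff del: insert_Diff_single)
      qed
      moreover have "F' - {{i, k}} \<subseteq> F" using eq(1) by auto
      ultimately have "conn F k' r" by (rule conn_mono)
      then have "conn F i r" by (rule conn_trans[OF conn_edge[OF ik(2)]])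
      then show False
        using rooted_forestD(4)[OF rf(1) i(1), of r i] r(1) R \<open>r \<noteq> i\<close> by auto
    qed
    moreover have "{i, k} \<notin> F" "{i, k'} \<notin> F'" using k conn_edge by metis+
    ultimately show "F = F' \<and> R = R' \<and> k = k'"
      using eq(1) R by (auto simp: insert_ident)
  qed
  show "join_root i ` joinable E i = {FR \<in> rooted_forests E. i \<notin> snd FR}"
  proof (intro equalityI subsetI)
    fix FR assume "FR \<in> join_root i ` joinable E i"
    then show "FR \<in> {FR \<in> rooted_forests E. i \<notin> snd FR}"
      by (auto simp: forests_rooted_at_def intro: join_root_rooted_forest[OF assms])
  next
    fix FR assume "FR \<in> {FR \<in> rooted_forests E. i \<notin> snd FR}"
    then obtain F R where FR: "FR = (F, R)" "spanning_rooted_forest E (F, R)" "i \<notin> R"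
      by (cases FR) auto
    then obtain k where "{i, k} \<in> F" "E i k" "\<not> conn (F - {{i, k}}) i k"
      "spanning_rooted_forest E (F - {{i, k}}, insert i R)"
      using detach_rooted_forest[OF assms] by metis
    with FR show "FR \<in> join_root i ` joinable E i"
      by (intro image_eqI[of _ _ "((F - {{i, k}}, insert i R), k)"])
        (auto simp: forests_rooted_at_def)
  qed
qed

section \<open>The matrix forest theorem\<close>

definition root_ind :: "'n set set \<times> 'n set \<Rightarrow> 'n \<Rightarrow> 'n \<Rightarrow> real" where
  "root_ind FR x j = of_bool (j \<in> snd FR \<and> conn (fst FR) x j)"

definition forest_count :: "('n::finite \<Rightarrow> 'n \<Rightarrow> bool) \<Rightarrow> 'n \<Rightarrow> 'n \<Rightarrow> real" where
  "forest_count E x j = (\<Sum>FR\<in>rooted_forests E. root_ind FR x j)"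

lemma root_ind_root:
  assumes "FR \<in> forests_rooted_at E i"
  shows "root_ind FR i j = of_bool (i = j)"
proof -
  obtain F R where FR: "FR = (F, R)" by (cases FR)
  have rf: "spanning_rooted_forest E (F, R)" "i \<in> R"
    using assms by (auto simp: FR forests_rooted_at_def)
  have "j \<in> R \<and> conn F i j \<longleftrightarrow> i = j"
    using rooted_forestD(4)[OF rf(1,2), of j i] rf(2) by auto
  then show ?thesis by (simp add: FR root_ind_def)
qed

text \<open>Only the vertices in the tree of \<open>i\<close> change their root, namely to that of
  \<open>k\<close>. Writing this as a correction with factor \<open>root_ind FR x i\<close> makes it
  easy to sum over \<open>x\<close>.\<close>

lemma root_ind_join_root:
  assumes "(FR, k) \<in> joinable E i"
  shows "root_ind (join_root i (FR, k)) x j =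
    root_ind FR x j + root_ind FR x i * (root_ind FR k j - of_bool (i = j))"
proof -
  obtain F R where FR: "FR = (F, R)" by (cases FR)
  have rf: "spanning_rooted_forest E (F, R)" "i \<in> R" and k: "\<not> conn F k i"
    using assms by (auto simp: FR forests_rooted_at_def conn_commute)
  show ?thesis
  proof (cases "j \<in> R \<and> j \<noteq> i")
    case True
    then have "\<not> (conn F x j \<and> conn F x i)"
      using rooted_forestD(4)[OF rf, of j x] by auto
    then show ?thesis
      using True rf(2) conn_joined_root_iff[OF rf, of j k x] by (auto simp: FR root_ind_def)
  next
    case False
    then show ?thesis using k rf(2) by (auto simp: FR root_ind_def)
  qed
qed

text \<open>The bijection \<open>join_root i\<close> groups each forest rooted at \<open>i\<close>
  with all forests obtained from it by joining \<open>i\<close> to a neighbour.\<close>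

lemma sum_rooted_forests_split:
  fixes E :: "'n::finite \<Rightarrow> 'n \<Rightarrow> bool" and h :: "'n set set \<times> 'n set \<Rightarrow> real"
  assumes "simple_graph E"
  shows "(\<Sum>FR\<in>rooted_forests E. h FR) = (\<Sum>FR\<in>forests_rooted_at E i.
    h FR + (\<Sum>k | E i k \<and> \<not> conn (fst FR) i k. h (join_root i (FR, k))))"
proof -
  let ?A = "forests_rooted_at E i" and ?B = "{FR \<in> rooted_forests E. i \<notin> snd FR}"
  have "rooted_forests E = ?A \<union> ?B"
    by (auto simp: forests_rooted_at_def)
  then have "sum h (rooted_forests E) = sum h (?A \<union> ?B)" by (rule arg_cong)
  also have "\<dots> = sum h ?A + sum h ?B"
    by (rule sum.union_disjoint) (auto simp: forests_rooted_at_def)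
  also have "sum h ?B = (\<Sum>p\<in>joinable E i. h (join_root i p))"
    by (rule sum.reindex_bij_betw[OF bij_betw_join_root[OF assms], symmetric])
  also have "\<dots> = (\<Sum>FR\<in>?A. \<Sum>k | E i k \<and> \<not> conn (fst FR) i k. h (join_root i (FR, k)))"
    by (subst sum.Sigma) (auto intro!: sum.cong)
  finally show ?thesis by (simp add: sum.distrib)
qed

text \<open>This is the entry at \<open>i\<close>, \<open>j\<close> of
  \<open>(I + L) N = f I\<close>. It holds because the contributions cancel within each group of
  \<open>sum_rooted_forests_split\<close>.\<close>

lemma forest_count_recurrence:
  fixes E :: "'n::finite \<Rightarrow> 'n \<Rightarrow> bool"
  assumes "simple_graph E"
  shows "(1 + real (degree E i)) * forest_count E i j - (\<Sum>x | E i x. forest_count E x j) =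
    of_bool (i = j) * real (card (rooted_forests E))"
proof -
  define d where "d = real (degree E i)"
  \<comment> \<open>The contribution of one forest to the difference of the two sides.\<close>
  define h where "h FR = (1 + d) * root_ind FR i j - (\<Sum>x | E i x. root_ind FR x j) - of_bool (i = j)"
    for FR
  have fibre: "h FR + (\<Sum>k | E i k \<and> \<not> conn (fst FR) i k. h (join_root i (FR, k))) = 0"
    if FR: "FR \<in> forests_rooted_at E i" for FR
  proof -
    let ?K = "{k. E i k \<and> \<not> conn (fst FR) i k}"
    \<comment> \<open>The number of neighbours of \<open>i\<close> in the tree with root
      \<open>l\<close>, which is zero if \<open>l\<close> is not a root. In particular
      \<open>d - a i\<close> neighbours lie in other trees.\<close>
    define a where "a l = (\<Sum>x | E i x. root_ind FR x l)" for l
    have iR: "i \<in> snd FR" using FR by (simp add: forests_rooted_at_def)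
    have ind_i: "root_ind FR k i = of_bool (conn (fst FR) i k)" for k
      using iR by (simp add: root_ind_def conn_commute)
    have h_FR: "h FR = d * of_bool (i = j) - a j"
      using root_ind_root[OF FR, of j] by (simp add: h_def a_def algebra_simps)
    have h_join: "h (join_root i (FR, k)) =
        (1 + d - a i) * root_ind FR k j - a j + (a i - 1) * of_bool (i = j)" if "k \<in> ?K" for k
    proof -
      have "(FR, k) \<in> joinable E i" using FR that by auto
      note eq = root_ind_join_root[OF this]
      have "(\<Sum>x | E i x. root_ind (join_root i (FR, k)) x j) =
          a j + a i * (root_ind FR k j - of_bool (i = j))"
        unfolding eq a_def by (simp add: sum.distrib sum_distrib_right)
      moreover have "root_ind (join_root i (FR, k)) i j = root_ind FR k j"
        unfolding eq using root_ind_root[OF FR] by simp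
      ultimately show ?thesis unfolding h_def by (simp add: algebra_simps)
    qed
    have "{k. E i k} = ?K \<union> {k. E i k \<and> conn (fst FR) i k}" by auto
    then have split: "sum g {k. E i k} = sum g ?K + sum g {k. E i k \<and> conn (fst FR) i k}"
      for g :: "'n \<Rightarrow> real"
      by (subst sum.union_disjoint[symmetric]) auto
    have card_K: "real (card ?K) = d - a i"
      using split[of "\<lambda>k. 1 - root_ind FR k i"]
      by (simp add: ind_i a_def d_def degree_def sum_subtractf)
    \<comment> \<open>No vertex of \<open>?K\<close> has root \<open>i\<close>, whereas for
      \<open>j \<noteq> i\<close> every neighbour with root \<open>j\<close> belongs to
      \<open>?K\<close>.\<close>
    have K_j: "(\<Sum>k\<in>?K. root_ind FR k j) = a j * (1 - of_bool (i = j))"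
    proof (cases "i = j")
      case True
      then show ?thesis by (simp add: ind_i flip: True)
    next
      case False
      have "root_ind FR k j = 0" if "conn (fst FR) i k" for k
      proof -
        have "root_ind FR i j = 0" using root_ind_root[OF FR] False by simp
        then show ?thesis using that conn_trans unfolding root_ind_def by fastforce
      qed
      then show ?thesis using False split[of "\<lambda>k. root_ind FR k j"] by (simp add: a_def)
    qed
    have "(\<Sum>k\<in>?K. h (join_root i (FR, k))) =
        (1 + d - a i) * (a j * (1 - of_bool (i = j))) + (d - a i) * ((a i - 1) * of_bool (i = j) - a j)"
      using h_join
      by (simp add: sum.distrib sum_subtractf flip: sum_distrib_left K_j card_K)
         (simp add: algebra_simps)
    \<comment> \<open>For \<open>i = j\<close> the forest gives \<open>d - a i\<close> and its joins
      give the negative of that; otherwise the two parts are \<open>- a j\<close> and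
      \<open>a j\<close>.\<close>
    with h_FR show ?thesis by (cases "i = j") (auto simp: algebra_simps)
  qed
  have "(\<Sum>FR\<in>rooted_forests E. h FR) = 0"
    unfolding sum_rooted_forests_split[OF assms, of h i] using fibre by simp
  moreover have "(\<Sum>FR\<in>rooted_forests E. \<Sum>x | E i x. root_ind FR x j) =
      (\<Sum>x | E i x. forest_count E x j)"
    unfolding forest_count_def by (rule sum.swap)
  moreover have "(\<Sum>FR\<in>rooted_forests E. (1 + d) * root_ind FR i j) = (1 + d) * forest_count E i j"
    by (simp add: forest_count_def sum_distrib_left)
  ultimately show ?thesis
    by (simp add: h_def d_def sum_subtractf mult.commute)
qed

text \<open>The edgeless forest in which every vertex is a root is counted by both. The two numbers
  occur as denominators.\<close>

lemma card_rooted_forests_pos: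
  fixes E :: "'n::finite \<Rightarrow> 'n \<Rightarrow> bool"
  shows "0 < card (forests_rooted_at E u)" "0 < card (rooted_forests E)"
proof -
  have "\<not> has_cycle {}" unfolding has_cycle_def by force
  then have "spanning_rooted_forest E ({}, UNIV)"
    by (intro rooted_forestI) auto
  then show "0 < card (forests_rooted_at E u)" "0 < card (rooted_forests E)"
    by (auto simp: card_gt_0_iff forests_rooted_at_def)
qed

lemma sum_indicator_neighbours:
  fixes E :: "'n::finite \<Rightarrow> 'n \<Rightarrow> bool" and g :: "'n \<Rightarrow> real"
  shows "(\<Sum>x\<in>UNIV. of_bool (E i x) * g x) = (\<Sum>x | E i x. g x)"
  by (simp add: sum.inter_filter[of UNIV, simplified] of_bool_def if_distrib[of "\<lambda>c. c * _"] cong: if_cong)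

text \<open>A one-sided inverse of a square matrix over a field is two-sided, so the choice in
  \<open>matrix_inv\<close> has a witness and must agree with \<open>B\<close>.\<close>

lemma matrix_inv_eq:
  fixes A B :: "'a::field^'n^'n"
  assumes "A ** B = mat 1"
  shows "matrix_inv A = B"
proof -
  have "B ** A = mat 1" using assms by (simp add: matrix_left_right_inverse)
  with assms have "\<exists>C. A ** C = mat 1 \<and> C ** A = mat 1" by blast
  from someI_ex[OF this] have "matrix_inv A ** A = mat 1" by (simp add: matrix_inv_def)
  with assms show ?thesis by (metis matrix_mul_assoc matrix_mul_lid matrix_mul_rid)
qed

text \<open>By \<open>forest_count_recurrence\<close>, the matrix of counts divided by the number of
  forests is a right inverse of \<open>mat 1 + laplacian E\<close>.\<close>

lemma forest_matrix_nth:
  fixes E :: "'n::finite \<Rightarrow> 'n \<Rightarrow> bool"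
  assumes "simple_graph E"
  shows "forest_matrix E $ i $ j = forest_count E i j / real (card (rooted_forests E))"
proof -
  let ?c = "real (card (rooted_forests E))"
  define N :: "real^'n^'n" where "N = (\<chi> i j. forest_count E i j / ?c)"
  let ?M = "mat 1 + laplacian E"
  have c: "?c \<noteq> 0" using card_rooted_forests_pos(2)[of E] by linarith
  have "(?M ** N) $ i $ j = mat 1 $ i $ j" for i j
  proof -
    have M: "?M $ i $ x = of_bool (x = i) * (1 + real (degree E i)) - of_bool (E i x)" for x
      by (simp add: mat_def laplacian_def degree_matrix_def adjacency_matrix_def)
    have "(?M ** N) $ i $ j = (\<Sum>x\<in>UNIV. ?M $ i $ x * N $ x $ j)"
      by (simp add: matrix_matrix_mult_def)
    also have "\<dots> = (\<Sum>x\<in>UNIV. of_bool (x = i) * ((1 + real (degree E i)) * forest_count E i j / ?c)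
        - of_bool (E i x) * (forest_count E x j * inverse ?c))"
      unfolding M by (intro sum.cong) (auto simp: N_def left_diff_distrib divide_inverse algebra_simps)
    also have "\<dots> = ((1 + real (degree E i)) * forest_count E i j - (\<Sum>x | E i x. forest_count E x j)) / ?c"
      unfolding sum_subtractf sum_indicator_neighbours sum_distrib_right[symmetric]
      by (simp add: left_diff_distrib divide_inverse sum_distrib_right)
    finally have "(?M ** N) $ i $ j = \<dots>" .
    then show ?thesis
      unfolding forest_count_recurrence[OF assms] nonzero_mult_div_cancel_right[OF c]
      by (simp add: mat_def)
  qed
  then have "?M ** N = mat 1" by (simp add: vec_eq_iff)
  then have "matrix_inv ?M = N" by (rule matrix_inv_eq)
  then show ?thesis by (simp add: forest_matrix_def N_def)
qed

section \<open>Column sums, tree sizes and the similarity ratio\<close>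

text \<open>When the recurrence is summed over \<open>i\<close>, symmetry of \<open>E\<close> makes
  each \<open>forest_count E x j\<close> appear \<open>degree E x\<close> times with a minus sign,
  which cancels the degree terms.\<close>

lemma sum_forest_count_column:
  fixes E :: "'n::finite \<Rightarrow> 'n \<Rightarrow> bool"
  assumes "simple_graph E"
  shows "(\<Sum>x\<in>UNIV. forest_count E x j) = real (card (rooted_forests E))"
proof -
  let ?N = "forest_count E"
  have "(\<Sum>i\<in>UNIV. \<Sum>x | E i x. ?N x j) = (\<Sum>x\<in>UNIV. \<Sum>i\<in>UNIV. of_bool (E i x) * ?N x j)"
    by (subst sum.swap) (simp add: sum_indicator_neighbours)
  also have "\<dots> = (\<Sum>x\<in>UNIV. \<Sum>i\<in>UNIV. of_bool (E x i) * ?N x j)"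
  proof -
    have "E i x \<longleftrightarrow> E x i" for i x using assms unfolding simple_graph_def by blast
    then show ?thesis by simp
  qed
  also have "\<dots> = (\<Sum>x\<in>UNIV. real (degree E x) * ?N x j)"
    by (simp add: sum_indicator_neighbours degree_def)
  finally have "(\<Sum>i\<in>UNIV. ?N i j) =
      (\<Sum>i\<in>UNIV. (1 + real (degree E i)) * ?N i j - (\<Sum>x | E i x. ?N x j))"
    by (simp add: sum_subtractf distrib_right sum.distrib)
  also have "\<dots> = real (card (rooted_forests E))"
    by (simp add: forest_count_recurrence[OF assms] flip: sum_distrib_right)
  finally show ?thesis .
qed

lemma forest_count_diag:
  "forest_count E u u = real (card (forests_rooted_at E u))"
proof -
  have "forest_count E u u = (\<Sum>FR\<in>rooted_forests E. if u \<in> snd FR then 1 else 0)"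
    unfolding forest_count_def root_ind_def by (intro sum.cong) auto
  also have "\<dots> = real (card {FR \<in> rooted_forests E. u \<in> snd FR})"
    by (simp add: sum.inter_filter[symmetric] del: mem_Collect_eq)
  finally show ?thesis by (simp add: forests_rooted_at_def)
qed

text \<open>Double counting of pairs of a forest rooted at \<open>u\<close> and a vertex in the tree
  of \<open>u\<close>.\<close>

lemma sum_tree_size:
  "(\<Sum>FR\<in>forests_rooted_at E u. real (tree_size (fst FR) u)) = (\<Sum>x\<in>UNIV. forest_count E x u)"
proof -
  have "(\<Sum>x\<in>UNIV. forest_count E x u) = (\<Sum>FR\<in>rooted_forests E. \<Sum>x\<in>UNIV. root_ind FR x u)"
    unfolding forest_count_def by (rule sum.swap)
  also have "\<dots> = (\<Sum>FR\<in>rooted_forests E. if u \<in> snd FR then real (tree_size (fst FR) u) else 0)"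
    by (intro sum.cong) (auto simp: root_ind_def tree_size_def conn_commute[of _ _ u])
  also have "\<dots> = (\<Sum>FR\<in>forests_rooted_at E u. real (tree_size (fst FR) u))"
    unfolding forests_rooted_at_def by (subst sum.inter_filter[symmetric]) auto
  finally show ?thesis ..
qed

lemma forest_matrix_diag_pos:
  fixes E :: "'n::finite \<Rightarrow> 'n \<Rightarrow> bool"
  assumes "simple_graph E"
  shows "0 < forest_matrix E $ u $ u"
  using card_rooted_forests_pos[of E]
  by (simp add: forest_matrix_nth[OF assms] forest_count_diag)

lemma s_val_eq_inverse_forest_matrix:
  fixes E :: "'n::finite \<Rightarrow> 'n \<Rightarrow> bool"
  assumes "simple_graph E"
  shows "s_val E u = inverse (forest_matrix E $ u $ u)"
  by (simp add: s_val_def sum_tree_size sum_forest_count_column[OF assms]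
      forest_matrix_nth[OF assms] forest_count_diag)

text \<open>Inversion reverses the order of positive elements, so it exchanges minimum and maximum
  and the quotient is unchanged.\<close>

lemma min_div_max_inverse:
  fixes a b :: "'a::linordered_field"
  assumes "0 < a" "0 < b"
  shows "min (inverse a) (inverse b) / max (inverse a) (inverse b) = min a b / max a b"
  using assms by (auto simp: min_def max_def field_simps)

theorem theorem4p5:
  fixes E :: "'n::finite \<Rightarrow> 'n \<Rightarrow> bool" and u v :: 'n
  assumes "simple_graph E"
  shows "forest_sim E u v =
    min (forest_matrix E $ u $ u) (forest_matrix E $ v $ v) /
    max (forest_matrix E $ u $ u) (forest_matrix E $ v $ v)"
  unfolding forest_sim_def s_val_eq_inverse_forest_matrix[OF assms]
  by (intro min_div_max_inverse forest_matrix_diag_pos[OF assms])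

end
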